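(* Let $G$ be a second countable locally compact group and $G\curvearrowright \mathrm X$ a nonsingular measurable action on a standard probability space $\mathrm X=(X,\mu)$. Then the induced action of $G$ on $L^\infty(\mathrm X)$ is strongly continuous with respect to the $L^1$-norm; that is, for every $f\in L^\infty(\mathrm X)$ the map $G\to L^\infty(\mathrm X)$, $g\mapsto T_{g^{-1}}f$, is continuous when $L^\infty(\mathrm X)$ is equipped with the norm $\|\cdot\|_{L^1(\mathrm X)}$.
   Context: A nonsingular measurable action of $G$ on $\mathrm X=(X,\mu)$ is a group action such that $G\times X\to X$ is measurable and $g_*\mu$ and $\mu$ are mutually absolutely continuous for every $g\in G$. For $g\in G$, $T_g\colon L^\infty(\mathrm X)\to L^\infty(\mathrm X)$ is the Koopman operator $(T_gf)(x)=f(gx)$; the induced action of $G$ on $L^\infty(\mathrm X)$ is $g\mapsto T_{g^{-1}}$. *)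

theory Defs
  imports "HOL-Probability.Probability"
begin

text \<open>A group is a type of class \<open>topological_group_add\<close>. That class does not assume commutativity:
  \<open>g + h\<close>, \<open>0\<close>, \<open>- g\<close> stand for \<open>gh\<close>, \<open>e\<close>, \<open>g\<inverse>\<close> in an arbitrary topological group.\<close>

definition standard_borel_space :: "'a measure \<Rightarrow> bool" where
  "standard_borel_space M \<longleftrightarrow>
     (\<exists>T. topspace T = space M \<and> completely_metrizable_space T \<and> second_countable T \<and>
          sets M = sigma_sets (space M) {U. openin T U})"

definition standard_prob_space :: "'a measure \<Rightarrow> bool" where
  "standard_prob_space M \<longleftrightarrow> prob_space M \<and> standard_borel_space M"

text \<open>Measurability of the joint action map makes every \<open>act g\<close> a measurable self-map of
  \<open>space M\<close>, so \<open>distr M M (act g)\<close> is the push-forward measure.\<close>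

definition nonsingular_action ::
    "'a measure \<Rightarrow> ('g::topological_group_add \<Rightarrow> 'a \<Rightarrow> 'a) \<Rightarrow> bool" where
  "nonsingular_action M act \<longleftrightarrow>
     (\<lambda>(g, x). act g x) \<in> borel \<Otimes>\<^sub>M M \<rightarrow>\<^sub>M M \<and>
     (\<forall>x\<in>space M. act 0 x = x) \<and>
     (\<forall>g h. \<forall>x\<in>space M. act (g + h) x = act g (act h x)) \<and>
     (\<forall>g. absolutely_continuous M (distr M M (act g)) \<and>
          absolutely_continuous (distr M M (act g)) M)"

definition Linf_fun :: "'a measure \<Rightarrow> ('a \<Rightarrow> complex) set" where
  "Linf_fun M = {f \<in> borel_measurable M. \<exists>C. AE x in M. norm (f x) \<le> C}"

definition ae_eq :: "'a measure \<Rightarrow> (('a \<Rightarrow> complex) \<times> ('a \<Rightarrow> complex)) set" where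
  "ae_eq M = {(f, g). f \<in> Linf_fun M \<and> g \<in> Linf_fun M \<and> (AE x in M. f x = g x)}"

definition Linf :: "'a measure \<Rightarrow> ('a \<Rightarrow> complex) set set" where
  "Linf M = Linf_fun M // ae_eq M"

text \<open>The operations on classes are defined by unions over all representatives; the lemmas at the
  end of the theory show that they do not depend on the representatives and that \<open>L1_dist\<close> is a metric.\<close>

definition koopman ::
    "'a measure \<Rightarrow> ('g \<Rightarrow> 'a \<Rightarrow> 'a) \<Rightarrow> 'g \<Rightarrow> ('a \<Rightarrow> complex) set \<Rightarrow> ('a \<Rightarrow> complex) set" where
  "koopman M act g F = (\<Union>f\<in>F. ae_eq M `` {\<lambda>x. f (act g x)})"

definition Linf_diff ::
    "'a measure \<Rightarrow> ('a \<Rightarrow> complex) set \<Rightarrow> ('a \<Rightarrow> complex) set \<Rightarrow> ('a \<Rightarrow> complex) set" where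
  "Linf_diff M F G = (\<Union>f\<in>F. \<Union>g\<in>G. ae_eq M `` {\<lambda>x. f x - g x})"

definition L1_norm :: "'a measure \<Rightarrow> ('a \<Rightarrow> complex) set \<Rightarrow> real" where
  "L1_norm M F = (LINT x|M. norm ((SOME f. f \<in> F) x))"

text \<open>The locale \<open>Metric_space\<close> demands symmetry also off the carrier, hence the value \<open>0\<close> there.\<close>

definition L1_dist :: "'a measure \<Rightarrow> ('a \<Rightarrow> complex) set \<Rightarrow> ('a \<Rightarrow> complex) set \<Rightarrow> real" where
  "L1_dist M F G = (if F \<in> Linf M \<and> G \<in> Linf M then L1_norm M (Linf_diff M F G) else 0)"

definition Linf_L1_topology :: "'a measure \<Rightarrow> ('a \<Rightarrow> complex) set topology" where
  "Linf_L1_topology M = Metric_space.mtopology (Linf M) (L1_dist M)"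

lemma equiv_ae_eq: "equiv (Linf_fun M) (ae_eq M)"
proof (rule equivI)
  show "ae_eq M \<subseteq> Linf_fun M \<times> Linf_fun M" by (auto simp: ae_eq_def)
  show "refl_on (Linf_fun M) (ae_eq M)" by (auto simp: ae_eq_def refl_on_def)
  show "sym (ae_eq M)" by (auto simp: ae_eq_def sym_def)
  show "trans (ae_eq M)" by (auto simp: ae_eq_def trans_def)
qed

lemma ae_eq_class_eqI: "(f, g) \<in> ae_eq M \<Longrightarrow> ae_eq M `` {f} = ae_eq M `` {g}"
  by (rule equiv_class_eq[OF equiv_ae_eq])

lemma Linf_cases:
  assumes "F \<in> Linf M"
  obtains f where "f \<in> Linf_fun M" "F = ae_eq M `` {f}"
  using assms by (auto simp: Linf_def elim: quotientE)

lemma class_in_Linf: "f \<in> Linf_fun M \<Longrightarrow> ae_eq M `` {f} \<in> Linf M"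
  by (simp add: Linf_def quotientI)

lemma Linf_fun_diff:
  assumes "f \<in> Linf_fun M" "g \<in> Linf_fun M"
  shows "(\<lambda>x. f x - g x) \<in> Linf_fun M"
proof -
  obtain C D where "AE x in M. norm (f x) \<le> C" "AE x in M. norm (g x) \<le> D"
    using assms by (auto simp: Linf_fun_def)
  then have "AE x in M. norm (f x - g x) \<le> C + D"
    by eventually_elim (meson add_mono norm_triangle_ineq4 order_trans)
  with assms show ?thesis by (auto simp: Linf_fun_def)
qed

lemma Linf_fun_integrable:
  assumes "prob_space M" "f \<in> Linf_fun M"
  shows "integrable M f"
proof -
  interpret prob_space M by fact
  show ?thesis
    using assms(2) by (auto simp: Linf_fun_def intro: integrable_const_bound)
qed

lemma act_measurable:
  assumes "nonsingular_action M act"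
  shows "act g \<in> M \<rightarrow>\<^sub>M M"
proof -
  have "(\<lambda>(g, x). act g x) \<in> borel \<Otimes>\<^sub>M M \<rightarrow>\<^sub>M M"
    using assms by (simp add: nonsingular_action_def)
  moreover have "(\<lambda>x. (g, x)) \<in> M \<rightarrow>\<^sub>M borel \<Otimes>\<^sub>M M" by measurable
  ultimately have "(\<lambda>x. (\<lambda>(g, x). act g x) (g, x)) \<in> M \<rightarrow>\<^sub>M M"
    by (rule measurable_compose[rotated])
  then show ?thesis by simp
qed

lemma act_AE:
  assumes "nonsingular_action M act" "AE x in M. P x"
  shows "AE x in M. P (act g x)"
proof -
  from assms(2) obtain N where N: "N \<in> null_sets M" "{x \<in> space M. \<not> P x} \<subseteq> N"
    by (auto simp: eventually_ae_filter)
  have "N \<in> null_sets (distr M M (act g))"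
    using assms(1) N(1) by (auto simp: nonsingular_action_def absolutely_continuous_def)
  then have "act g -` N \<inter> space M \<in> null_sets M"
    using act_measurable[OF assms(1)] by (auto simp: null_sets_distr_iff)
  moreover have "{x \<in> space M. \<not> P (act g x)} \<subseteq> act g -` N \<inter> space M"
    using N(2) measurable_space[OF act_measurable[OF assms(1)]] by auto
  ultimately show ?thesis by (rule AE_I')
qed

lemma Linf_fun_act:
  assumes "nonsingular_action M act" "f \<in> Linf_fun M"
  shows "(\<lambda>x. f (act g x)) \<in> Linf_fun M"
proof -
  from assms(2) obtain C where C: "AE x in M. norm (f x) \<le> C" and f: "f \<in> borel_measurable M"
    by (auto simp: Linf_fun_def)
  have "AE x in M. norm (f (act g x)) \<le> C"
    using act_AE[OF assms(1) C] .
  with measurable_compose[OF act_measurable[OF assms(1)] f] show ?thesis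
    by (auto simp: Linf_fun_def)
qed

lemma koopman_class:
  assumes "nonsingular_action M act" "f \<in> Linf_fun M"
  shows "koopman M act g (ae_eq M `` {f}) = ae_eq M `` {\<lambda>x. f (act g x)}"
  unfolding koopman_def
proof (rule UN_equiv_class[OF equiv_ae_eq _ assms(2)])
  show "(\<lambda>f. ae_eq M `` {\<lambda>x. f (act g x)}) respects ae_eq M"
  proof (rule congruentI)
    fix f h assume fh: "(f, h) \<in> ae_eq M"
    then have "AE x in M. f (act g x) = h (act g x)"
      by (intro act_AE[OF assms(1)]) (auto simp: ae_eq_def)
    with fh show "ae_eq M `` {\<lambda>x. f (act g x)} = ae_eq M `` {\<lambda>x. h (act g x)}"
      by (intro ae_eq_class_eqI) (auto simp: ae_eq_def intro: Linf_fun_act[OF assms(1)])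
  qed
qed

lemma koopman_in_Linf:
  assumes "nonsingular_action M act" "F \<in> Linf M"
  shows "koopman M act g F \<in> Linf M"
  using assms by (auto elim!: Linf_cases simp: koopman_class intro!: class_in_Linf Linf_fun_act)

lemma Linf_diff_class:
  assumes "f \<in> Linf_fun M" "g \<in> Linf_fun M"
  shows "Linf_diff M (ae_eq M `` {f}) (ae_eq M `` {g}) = ae_eq M `` {\<lambda>x. f x - g x}"
  unfolding Linf_diff_def
proof (rule UN_equiv_class2[OF equiv_ae_eq equiv_ae_eq _ assms])
  show "congruent2 (ae_eq M) (ae_eq M) (\<lambda>f g. ae_eq M `` {\<lambda>x. f x - g x})"
    by (rule congruent2I', rule ae_eq_class_eqI) (auto simp: ae_eq_def intro: Linf_fun_diff)
qed

lemma L1_norm_class: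
  assumes "f \<in> Linf_fun M"
  shows "L1_norm M (ae_eq M `` {f}) = (LINT x|M. norm (f x))"
proof -
  define h where "h = (SOME h. h \<in> ae_eq M `` {f})"
  have "h \<in> ae_eq M `` {f}"
    unfolding h_def by (rule someI[of _ f]) (use assms in \<open>auto simp: ae_eq_def\<close>)
  then have "h \<in> borel_measurable M" "f \<in> borel_measurable M" "AE x in M. f x = h x"
    by (auto simp: ae_eq_def Linf_fun_def)
  then have "(LINT x|M. norm (h x)) = (LINT x|M. norm (f x))"
    by (intro integral_cong_AE) auto
  then show ?thesis by (simp add: L1_norm_def h_def)
qed

lemma L1_dist_class:
  assumes "f \<in> Linf_fun M" "g \<in> Linf_fun M"
  shows "L1_dist M (ae_eq M `` {f}) (ae_eq M `` {g}) = (LINT x|M. norm (f x - g x))"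
  using assms by (simp add: L1_dist_def Linf_diff_class L1_norm_class Linf_fun_diff class_in_Linf)

lemma Metric_space_Linf_L1:
  assumes "prob_space M"
  shows "Metric_space (Linf M) (L1_dist M)"
proof
  fix F G show "0 \<le> L1_dist M F G" by (simp add: L1_dist_def L1_norm_def)
next
  fix F G show "L1_dist M F G = L1_dist M G F"
  proof (cases "F \<in> Linf M \<and> G \<in> Linf M")
    case True
    then show ?thesis
      by (auto elim!: Linf_cases simp: L1_dist_class norm_minus_commute)
  qed (auto simp: L1_dist_def)
next
  fix F G assume "F \<in> Linf M" "G \<in> Linf M"
  then obtain f g where f: "f \<in> Linf_fun M" "F = ae_eq M `` {f}"
    and g: "g \<in> Linf_fun M" "G = ae_eq M `` {g}"
    by (meson Linf_cases)
  have "integrable M (\<lambda>x. norm (f x - g x))"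
    using Linf_fun_integrable[OF assms Linf_fun_diff[OF f(1) g(1)]] by simp
  then have "L1_dist M F G = 0 \<longleftrightarrow> (AE x in M. norm (f x - g x) = 0)"
    by (simp add: f g L1_dist_class integral_nonneg_eq_0_iff_AE)
  also have "\<dots> \<longleftrightarrow> (f, g) \<in> ae_eq M"
    using f(1) g(1) by (simp add: ae_eq_def)
  also have "\<dots> \<longleftrightarrow> F = G"
    using eq_equiv_class_iff[OF equiv_ae_eq f(1) g(1)] by (simp add: f(2) g(2))
  finally show "L1_dist M F G = 0 \<longleftrightarrow> F = G" .
next
  fix F G H assume "F \<in> Linf M" "G \<in> Linf M" "H \<in> Linf M"
  then obtain f g h where f: "f \<in> Linf_fun M" "F = ae_eq M `` {f}"
    and g: "g \<in> Linf_fun M" "G = ae_eq M `` {g}"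
    and h: "h \<in> Linf_fun M" "H = ae_eq M `` {h}"
    by (meson Linf_cases)
  have int: "integrable M (\<lambda>x. norm (u x - v x))" if "u \<in> Linf_fun M" "v \<in> Linf_fun M" for u v
    using Linf_fun_integrable[OF assms Linf_fun_diff[OF that]] by simp
  have "(LINT x|M. norm (f x - h x)) \<le> (LINT x|M. norm (f x - g x) + norm (g x - h x))"
    by (intro integral_mono Bochner_Integration.integrable_add int f g h)
       (metis diff_add_cancel add_diff_eq norm_triangle_ineq)
  also have "\<dots> = (LINT x|M. norm (f x - g x)) + (LINT x|M. norm (g x - h x))"
    by (intro Bochner_Integration.integral_add int f g h)
  finally show "L1_dist M F H \<le> L1_dist M F G + L1_dist M G H"
    by (simp add: f g h L1_dist_class)
qed

end

theory Submission
  imports Defs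
begin

text \<open>The orbit map \<open>g \<mapsto> g\<inverse>A\<close> of a measurable set takes values in a separable part of the
  measure algebra and is Borel, so it is continuous on a comeagre subset of the group.  Given
  \<open>s\<^sub>n \<longrightarrow> g\<close>, Baire's theorem yields one \<open>h\<close> such that all \<open>s\<^sub>n h\<close> and \<open>gh\<close> lie in that subset,
  hence \<open>h\<inverse>s\<^sub>n\<inverse>A \<longrightarrow> h\<inverse>g\<inverse>A\<close>; translation by \<open>h\<close>, which is continuous on the measure algebra
  by absolute continuity, removes \<open>h\<close>.  A bounded function is reduced to sets by covering its
  range with finitely many small balls.\<close>

section \<open>Null sequences of sets under absolute continuity\<close>

text \<open>Otherwise there are sets \<open>B (r k)\<close> with summable \<open>M\<close>-measure
  and \<open>N\<close>-measure at least \<open>e\<close>. By Borel-Cantelli \<open>M\<close>-almost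
  every, hence \<open>N\<close>-almost every, point lies in only finitely many of them, and
  dominated convergence contradicts the bound \<open>e\<close>.\<close>

lemma tendsto_measure_absolutely_continuous:
  assumes "finite_measure M" "finite_measure N" "absolutely_continuous M N" "sets N = sets M"
    and B: "\<And>n. B n \<in> sets M"
    and lim: "(\<lambda>n. measure M (B n)) \<longlonglongrightarrow> 0"
  shows "(\<lambda>n. measure N (B n)) \<longlonglongrightarrow> 0"
proof (rule ccontr)
  interpret M: finite_measure M by fact
  interpret N: finite_measure N by fact
  assume "\<not> ?thesis"
  then obtain e where e: "e > 0" "\<exists>\<^sub>F n in sequentially. e \<le> measure N (B n)"
    by (auto simp: tendsto_iff not_eventually not_less)
  have "\<exists>n. measure M (B n) < (1/2)^k \<and> e \<le> measure N (B n)" for k :: nat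
  proof -
    have "\<forall>\<^sub>F n in sequentially. measure M (B n) < (1/2)^k"
      using order_tendstoD(2)[OF lim] by simp
    from frequently_ex[OF frequently_rev_mp[OF e(2) eventually_mono[OF this]]] show ?thesis
      by auto
  qed
  \<comment> \<open>The indices \<open>r k\<close> may repeat or decrease: the geometric bound gives
    summability, and together with the lower bound \<open>e\<close> that is enough.\<close>
  then obtain r where r: "\<And>k. measure M (B (r k)) < (1/2)^k" "\<And>k. e \<le> measure N (B (r k))"
    by metis
  have "summable (\<lambda>k. measure M (B (r k)))"
    by (rule summable_comparison_test'[OF summable_geometric[of "1/2::real"], of 0])
       (use r(1) less_imp_le in auto)
  then have "AE x in M. \<forall>\<^sub>F k in sequentially. x \<in> space M - B (r k)"
    by (intro borel_cantelli_AE1 B) (auto simp: less_top[symmetric])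
  then have "AE x in N. \<forall>\<^sub>F k in sequentially. x \<in> space M - B (r k)"
    using absolutely_continuous_AE[OF assms(4) assms(3)] by blast
  then have "AE x in N. (\<lambda>k. indicat_real (B (r k)) x) \<longlonglongrightarrow> 0"
  proof eventually_elim
    case (elim x)
    then have "\<forall>\<^sub>F k in sequentially. indicat_real (B (r k)) x = 0"
      by eventually_elim auto
    then show ?case by (rule tendsto_eventually)
  qed
  then have "(\<lambda>k. LINT x|N. indicat_real (B (r k)) x) \<longlonglongrightarrow> (LINT x|N. 0)"
    by (intro integral_dominated_convergence[where w = "\<lambda>_. 1"])
       (use B assms(4) in \<open>auto simp: indicator_def\<close>)
  moreover have "(LINT x|N. indicat_real (B (r k)) x) = measure N (B (r k))" for k
    using B assms(4) by simp
  ultimately have "(\<lambda>k. measure N (B (r k))) \<longlonglongrightarrow> 0" by simp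
  from LIMSEQ_le_const[OF this] r(2) e(1) show False by force
qed

section \<open>Separability of the sections of a product set\<close>

lemma (in finite_measure) measure_sym_diff_triangle:
  assumes "A \<in> sets M" "B \<in> sets M" "C \<in> sets M"
  shows "measure M (sym_diff A C) \<le> measure M (sym_diff A B) + measure M (sym_diff C B)"
proof -
  have "measure M (sym_diff A C) \<le> measure M (sym_diff A B \<union> sym_diff C B)"
    using assms by (intro finite_measure_mono) auto
  also have "\<dots> \<le> measure M (sym_diff A B) + measure M (sym_diff C B)"
    using assms by (intro measure_Un_le) auto
  finally show ?thesis .
qed

text \<open>Only countably many rectangles enter the generation of \<open>Q\<close>, so its sections
  lie in a countably generated sub-sigma-algebra, which is separable in measure. Induction on the
  generation of \<open>Q\<close> builds the approximating family directly.\<close>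

lemma (in finite_measure) separable_sections:
  assumes "Q \<in> sets (N \<Otimes>\<^sub>M M)"
  shows "\<exists>\<D>. countable \<D> \<and> \<D> \<subseteq> sets M \<and>
    (\<forall>y\<in>space N. \<forall>e>0. \<exists>D\<in>\<D>. measure M (sym_diff (Pair y -` Q) D) < e)"
proof -
  from assms have "Q \<in> sigma_sets (space N \<times> space M) {a \<times> b | a b. a \<in> sets N \<and> b \<in> sets M}"
    by (simp add: sets_pair_measure)
  then show ?thesis
  proof (induction)
    case (Basic Q)
    then obtain a b where "Q = a \<times> b" "a \<in> sets N" "b \<in> sets M" by auto
    \<comment> \<open>A section of the rectangle is \<open>b\<close> or empty.\<close>
    then show ?case
      by (intro exI[of _ "{{}, b}"]) (auto simp: Pair_vimage_Sigma)
  next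
    case Empty
    show ?case by (intro exI[of _ "{{}}"]) auto
  next
    case (Compl Q)
    then obtain \<D> where D: "countable \<D>" "\<D> \<subseteq> sets M"
      "\<And>y e. y \<in> space N \<Longrightarrow> 0 < e \<Longrightarrow> \<exists>D\<in>\<D>. measure M (sym_diff (Pair y -` Q) D) < e"
      by blast
    have Q: "Q \<in> sets (N \<Otimes>\<^sub>M M)" using Compl by (simp add: sets_pair_measure)
    \<comment> \<open>Complementation within \<open>space M\<close> preserves symmetric differences,
      so complementing every member of \<open>\<D>\<close> keeps the approximation.\<close>
    have *: "sym_diff (Pair y -` (space N \<times> space M - Q)) (space M - E) = sym_diff (Pair y -` Q) E"
      if "y \<in> space N" "E \<in> \<D>" for y E
      using that sets.sets_into_space[OF Q] D(2)[THEN subsetD, THEN sets.sets_into_space]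
      by (fastforce simp: space_pair_measure)
    show ?case
    proof (intro exI[of _ "(\<lambda>E. space M - E) ` \<D>"] conjI ballI allI impI)
      fix y e assume "y \<in> space N" "0 < (e::real)"
      then obtain E where E: "E \<in> \<D>" "measure M (sym_diff (Pair y -` Q) E) < e"
        using D(3) by blast
      show "\<exists>E\<in>(\<lambda>E. space M - E) ` \<D>.
          measure M (sym_diff (Pair y -` (space N \<times> space M - Q)) E) < e"
        by (rule bexI[OF _ imageI[OF E(1)]]) (unfold *[OF \<open>y \<in> space N\<close> E(1)], rule E(2))
    qed (use D(1,2) in auto)
  next
    case (Union Q)
    from choice[OF allI[OF Union.IH]] obtain \<D> where
      \<D>: "\<forall>i. countable (\<D> i) \<and> \<D> i \<subseteq> sets M \<and>
        (\<forall>y\<in>space N. \<forall>e>0. \<exists>D\<in>\<D> i. measure M (sym_diff (Pair y -` Q i) D) < e)"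
      by (rule exE)
    then have D: "\<And>i. countable (\<D> i)" "\<And>i. \<D> i \<subseteq> sets M"
      "\<And>i y e. y \<in> space N \<Longrightarrow> 0 < e \<Longrightarrow> \<exists>D\<in>\<D> i. measure M (sym_diff (Pair y -` Q i) D) < e"
      by simp_all
    have Q: "Q i \<in> sets (N \<Otimes>\<^sub>M M)" for i using Union by (simp add: sets_pair_measure)
    \<comment> \<open>Finite unions keep the family countable, and they suffice because the partial
      unions \<open>?P n\<close> exhaust the whole union in measure.\<close>
    let ?\<E> = "(\<Union>) ` {F. finite F \<and> F \<subseteq> (\<Union>i. \<D> i)}"
    show ?case
    proof (intro exI[of _ ?\<E>] conjI ballI allI impI)
      show "countable ?\<E>"
        using D(1) by (intro countable_image countable_Collect_finite_subset) auto
      show "?\<E> \<subseteq> sets M"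
        using D(2) by (auto intro!: sets.finite_Union) blast
      fix y and e :: real assume y: "y \<in> space N" and e: "0 < e"
      let ?A = "\<lambda>i. Pair y -` Q i"
      let ?P = "\<lambda>n. \<Union>i<n. ?A i"
      have A: "?A i \<in> sets M" for i using Q by (rule sets_Pair1)
      have "(\<lambda>n. measure M (?P n)) \<longlonglongrightarrow> measure M (\<Union>n. ?P n)"
        by (intro finite_Lim_measure_incseq) (use A in \<open>auto simp: incseq_def intro: order_less_le_trans\<close>)
      also have "(\<Union>n. ?P n) = Pair y -` (\<Union>i. Q i)" by auto
      finally have "\<forall>\<^sub>F n in sequentially. measure M (Pair y -` (\<Union>i. Q i)) - e/2 < measure M (?P n)"
        using e by (intro order_tendstoD(1)) auto
      then obtain n where n: "measure M (Pair y -` (\<Union>i. Q i)) - e/2 < measure M (?P n)"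
        by (auto simp: eventually_sequentially)
      \<comment> \<open>The \<open>n\<close> errors add up to at most \<open>e / 2\<close>, and the
        part outside \<open>?P n\<close> has measure below \<open>e / 2\<close>. The
        \<open>+ 1\<close> keeps the tolerance positive at \<open>n = 0\<close>.\<close>
      have "\<exists>E\<in>\<D> i. measure M (sym_diff (?A i) E) < e / (2 * (real n + 1))" for i
        by (rule D(3)[OF y]) (use e in auto)
      then obtain E where E: "\<And>i. E i \<in> \<D> i"
          "\<And>i. measure M (sym_diff (?A i) (E i)) < e / (2 * (real n + 1))"
        by metis
      have E': "E i \<in> sets M" for i using E(1) D(2) by auto
      let ?U = "Pair y -` (\<Union>i. Q i)"
      have U: "?U \<in> sets M" using Q by (intro sets_Pair1) auto
      have "measure M (sym_diff ?U (\<Union>i<n. E i)) \<le>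
          measure M ((?U - ?P n) \<union> (\<Union>i<n. sym_diff (?A i) (E i)))"
        using A E' U by (intro finite_measure_mono) auto
      also have "\<dots> \<le> measure M (?U - ?P n) + measure M (\<Union>i<n. sym_diff (?A i) (E i))"
        using A E' U by (intro measure_Un_le) auto
      finally have "measure M (sym_diff ?U (\<Union>i<n. E i)) \<le>
          measure M (?U - ?P n) + measure M (\<Union>i<n. sym_diff (?A i) (E i))" .
      moreover have "measure M (?U - ?P n) = measure M ?U - measure M (?P n)"
        using A U by (intro finite_measure_Diff) auto
      moreover have "measure M (\<Union>i<n. sym_diff (?A i) (E i)) \<le> e / 2"
      proof -
        have "measure M (\<Union>i<n. sym_diff (?A i) (E i)) \<le> (\<Sum>i<n. measure M (sym_diff (?A i) (E i)))"
          using A E' by (intro measure_UNION_le) auto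
        also have "\<dots> \<le> (\<Sum>i<n. e / (2 * (real n + 1)))"
          using E(2) by (intro sum_mono less_imp_le)
        also have "\<dots> \<le> e / 2"
          using e by (simp add: field_simps)
        finally show ?thesis .
      qed
      ultimately have "measure M (sym_diff ?U (\<Union>i<n. E i)) < e"
        using n by linarith
      moreover have "(\<Union>i<n. E i) \<in> ?\<E>"
        using E(1) by (intro image_eqI[of _ _ "E ` {..<n}"]) auto
      ultimately show "\<exists>D\<in>?\<E>. measure M (sym_diff ?U D) < e" by blast
    qed
  qed
qed

section \<open>Baire property and Baire category in the group\<close>

text \<open>Agreeing with an open set on a countable intersection of dense open sets is a property
  of open sets that survives complements and countable unions; for unions the families
  \<open>\<W>\<close> are merged.\<close>

lemma borel_Baire_property:
  assumes "E \<in> sets (borel :: 'b::topological_space measure)"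
  shows "\<exists>U \<W>. open U \<and> countable \<W> \<and> (\<forall>W\<in>\<W>. open W \<and> closure W = UNIV) \<and>
      E \<inter> \<Inter>\<W> = U \<inter> \<Inter>\<W>"
proof -
  have "E \<in> sigma_sets UNIV {S. open S}"
    using assms by (simp add: borel_def)
  then show ?thesis
  proof (induction)
    case (Basic E)
    then show ?case by (intro exI[of _ E] exI[of _ "{}"]) auto
  next
    case Empty
    show ?case by (intro exI[of _ "{}"]) auto
  next
    case (Compl E)
    then obtain U \<W> where U: "open U" "countable \<W>" "\<forall>W\<in>\<W>. open W \<and> closure W = UNIV"
      "E \<inter> \<Inter>\<W> = U \<inter> \<Inter>\<W>" by blast
    \<comment> \<open>The boundary of the open set \<open>U\<close> is nowhere dense. Its complement
      \<open>U \<union> ?V\<close> is the new dense open set, on which \<open>- U\<close> and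
      \<open>?V\<close> agree.\<close>
    let ?V = "interior (- U)"
    have "closure (U \<union> ?V) = UNIV"
      using closure_subset[of "- closure U"] by (auto simp: closure_Un interior_closure)
    moreover have "(UNIV - E) \<inter> \<Inter>(insert (U \<union> ?V) \<W>) = ?V \<inter> \<Inter>(insert (U \<union> ?V) \<W>)"
      using U(4) interior_subset[of "- U"] by auto
    ultimately show ?case
      using U by (intro exI[of _ ?V] exI[of _ "insert (U \<union> ?V) \<W>"]) auto
  next
    case (Union E)
    then have "\<forall>i. \<exists>U \<W>. open U \<and> countable \<W> \<and> (\<forall>W\<in>\<W>. open W \<and> closure W = UNIV) \<and>
      E i \<inter> \<Inter>\<W> = U \<inter> \<Inter>\<W>" by blast
    then obtain U \<W> where U: "\<And>i. open (U i)" "\<And>i. countable (\<W> i)"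
      "\<And>i. \<forall>W\<in>\<W> i. open W \<and> closure W = UNIV" "\<And>i. E i \<inter> \<Inter>(\<W> i) = U i \<inter> \<Inter>(\<W> i)"
      by metis
    have "(\<Union>i. E i) \<inter> \<Inter>(\<Union>i. \<W> i) = (\<Union>i. U i) \<inter> \<Inter>(\<Union>i. \<W> i)"
      using U(4) by blast
    then show ?case
      using U(1-3) by (intro exI[of _ "\<Union>i. U i"] exI[of _ "\<Union>i. \<W> i"]) auto
  qed
qed

lemma open_vimage_translate:
  fixes W :: "'g::topological_group_add set"
  assumes "open W"
  shows "open {h. k + h \<in> W}"
proof -
  have "continuous_on UNIV (\<lambda>h. k + h)" by (intro continuous_intros)
  from open_vimage[OF assms this] show ?thesis by (simp add: vimage_def)
qed

lemma dense_vimage_translate: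
  fixes W :: "'g::topological_group_add set"
  assumes "closure W = UNIV"
  shows "closure {h. k + h \<in> W} = UNIV"
proof -
  have "\<exists>h\<in>V. k + h \<in> W" if "open V" "V \<noteq> {}" for V
  proof -
    \<comment> \<open>This set is the translate \<open>k + V\<close>; being open and nonempty, it
      meets the dense set \<open>W\<close>.\<close>
    have "open {h. - k + h \<in> V}" using that by (intro open_vimage_translate)
    moreover from that obtain v where "v \<in> V" by auto
    then have "k + v \<in> {h. - k + h \<in> V}" by (simp add: add.assoc[symmetric])
    then have "{h. - k + h \<in> V} \<noteq> {}" by blast
    ultimately have "W \<inter> {h. - k + h \<in> V} \<noteq> {}"
      using assms open_Int_closure_eq_empty[of "{h. - k + h \<in> V}" W] by auto
    then obtain w where "w \<in> W" "- k + w \<in> V" by auto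
    then show ?thesis by (intro bexI[of _ "- k + w"]) (simp_all add: add.assoc[symmetric])
  qed
  then have "V \<inter> {h. k + h \<in> W} \<noteq> {}" if "open V" "V \<noteq> {}" for V
    using that by blast
  from this[of "- closure {h. k + h \<in> W}"] show ?thesis
    using closure_subset[of "{h. k + h \<in> W}"] by fastforce
qed

text \<open>The sets \<open>E i\<close> look open at all points \<open>k + h\<close> at once, for a
  single \<open>h\<close>. Each pair of a point \<open>k\<close> and a dense open set
  \<open>W\<close> from the Baire property asks for \<open>k + h \<in> W\<close>, a dense open
  condition on \<open>h\<close>; there are countably many, so Baire's theorem satisfies them
  together.\<close>

lemma borel_open_on_translate:
  fixes E :: "'i \<Rightarrow> 'g::{topological_group_add, t2_space} set"
  assumes "locally_compact_space (euclidean :: 'g topology)" "countable I" "countable K"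
    and E: "\<And>i. i \<in> I \<Longrightarrow> E i \<in> sets borel"
  shows "\<exists>h U. \<forall>i\<in>I. open (U i) \<and> (\<forall>k\<in>K. k + h \<in> E i \<longleftrightarrow> k + h \<in> U i)"
proof -
  have "\<forall>i\<in>I. \<exists>U \<W>. open U \<and> countable \<W> \<and> (\<forall>W\<in>\<W>. open W \<and> closure W = UNIV) \<and>
      E i \<inter> \<Inter>\<W> = U \<inter> \<Inter>\<W>"
    by (intro ballI borel_Baire_property E)
  then obtain U \<W> where U: "\<And>i. i \<in> I \<Longrightarrow> open (U i)" "\<And>i. i \<in> I \<Longrightarrow> countable (\<W> i)"
      "\<And>i W. i \<in> I \<Longrightarrow> W \<in> \<W> i \<Longrightarrow> open W \<and> closure W = UNIV"
      "\<And>i. i \<in> I \<Longrightarrow> E i \<inter> \<Inter>(\<W> i) = U i \<inter> \<Inter>(\<W> i)"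
    by metis
  let ?\<G> = "(\<lambda>(k, W). {h. k + h \<in> W}) ` (K \<times> (\<Union>i\<in>I. \<W> i))"
  \<comment> \<open>Hausdorff and locally compact give regular, the form in which Baire's theorem
    applies.\<close>
  have "Hausdorff_space (euclidean :: 'g topology)"
    unfolding Hausdorff_space_def disjnt_def by (metis hausdorff open_openin)
  then have "regular_space (euclidean :: 'g topology)"
    using assms(1) by (intro locally_compact_Hausdorff_imp_regular_space)
  then have "euclidean closure_of \<Inter>?\<G> = topspace (euclidean :: 'g topology)"
    using assms(1-3) U(2,3)
    by (intro Baire_category) (auto simp: open_vimage_translate dense_vimage_translate)
  then have "\<Inter>?\<G> \<noteq> {}" by (metis UNIV_not_empty closure_of_empty topspace_euclidean)
  then obtain h where h: "\<And>k i W. k \<in> K \<Longrightarrow> i \<in> I \<Longrightarrow> W \<in> \<W> i \<Longrightarrow> k + h \<in> W"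
    by auto
  have "k + h \<in> E i \<longleftrightarrow> k + h \<in> U i" if "i \<in> I" "k \<in> K" for i k
  proof -
    have "k + h \<in> \<Inter>(\<W> i)" using h that by blast
    then show ?thesis using U(4)[OF that(1)] by blast
  qed
  with U(1) show ?thesis by (intro exI[of _ h] exI[of _ U]) blast
qed

section \<open>Continuity of the action on measurable sets\<close>

lemma tendsto_measure_translated_sets:
  fixes act :: "'g::{topological_group_add, t2_space} \<Rightarrow> 'a \<Rightarrow> 'a"
  assumes "locally_compact_space (euclidean :: 'g topology)" "finite_measure M"
    and act: "nonsingular_action M act" and A: "A \<in> sets M" and lim: "s \<longlonglongrightarrow> g"
  shows "(\<lambda>n. measure M (sym_diff (act (s n) -` A \<inter> space M) (act g -` A \<inter> space M))) \<longlonglongrightarrow> 0"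
proof -
  interpret finite_measure M by fact
  define S where "S k = act k -` A \<inter> space M" for k
  have S: "S k \<in> sets M" for k
    unfolding S_def using act_measurable[OF act] A by (rule measurable_sets)
  \<comment> \<open>All preimages \<open>S k\<close> become sections of one product-measurable set.
    Joint measurability thus yields both a countable approximating family and Borel dependence on
    \<open>k\<close>.\<close>
  define Q where "Q = (\<lambda>(k, x). act k x) -` A \<inter> space (borel \<Otimes>\<^sub>M M)"
  have Q: "Q \<in> sets (borel \<Otimes>\<^sub>M M)"
    unfolding Q_def using act A by (intro measurable_sets) (auto simp: nonsingular_action_def)
  have Q_S: "Pair k -` Q = S k" for k
    by (auto simp: Q_def S_def space_pair_measure)
  obtain \<D> where \<D>: "countable \<D>" "\<D> \<subseteq> sets M"
    "\<And>k e. 0 < e \<Longrightarrow> \<exists>D\<in>\<D>. measure M (sym_diff (S k) D) < e"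
    using separable_sections[OF Q] unfolding Q_S space_borel by blast
  \<comment> \<open>\<open>E (D, m)\<close> is the set of \<open>k\<close> for which
    \<open>S k\<close> lies in the ball of radius \<open>1 / (m + 1)\<close> about \<open>D\<close>.
    Countably many such balls control the whole orbit, since \<open>\<D>\<close> approximates every
    \<open>S k\<close>.\<close>
  define E where "E = (\<lambda>(D, m). {k. measure M (sym_diff (S k) D) < 1 / real (Suc m)})"
  have E: "E i \<in> sets borel" if i: "i \<in> \<D> \<times> UNIV" for i
  proof -
    obtain D m where D: "i = (D, m)" "D \<in> sets M" using i \<D>(2) by (cases i) auto
    have "sym_diff Q (space borel \<times> D) \<in> sets (borel \<Otimes>\<^sub>M M)"
      using Q D by auto
    from measurable_emeasure_Pair[OF this]
    have "(\<lambda>k. emeasure M (sym_diff (S k) D)) \<in> borel_measurable borel"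
      by (simp add: vimage_Diff vimage_Un Q_S Pair_vimage_Sigma)
    then have "(\<lambda>k. measure M (sym_diff (S k) D)) \<in> borel_measurable borel"
      unfolding measure_def by measurable
    then show ?thesis unfolding E_def D by simp
  qed
  have "\<exists>h U. \<forall>i\<in>\<D> \<times> UNIV. open (U i) \<and> (\<forall>k\<in>insert g (range s). k + h \<in> E i \<longleftrightarrow> k + h \<in> U i)"
    using assms(1) \<D>(1) E by (intro borel_open_on_translate) auto
  then obtain h U where hU: "\<forall>i\<in>\<D> \<times> UNIV. open (U i) \<and>
      (\<forall>k\<in>insert g (range s). k + h \<in> E i \<longleftrightarrow> k + h \<in> U i)"
    by (elim exE)
  have U: "open (U i)" "k \<in> insert g (range s) \<Longrightarrow> k + h \<in> E i \<longleftrightarrow> k + h \<in> U i"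
    if "i \<in> \<D> \<times> UNIV" for i k
    using bspec[OF hU that] by blast+
  have lim_h: "(\<lambda>n. measure M (sym_diff (S (s n + h)) (S (g + h)))) \<longlonglongrightarrow> 0"
  proof (rule order_tendstoI)
    fix r :: real assume "0 < r"
    \<comment> \<open>Half of \<open>r\<close>, because \<open>S (s n + h)\<close> and
      \<open>S (g + h)\<close> are compared through a common \<open>D\<close>.\<close>
    then obtain m where m: "1 / real (Suc m) < r / 2"
      using nat_approx_posE[of "r / 2"] by auto
    obtain D where D: "D \<in> \<D>" "measure M (sym_diff (S (g + h)) D) < 1 / real (Suc m)"
      using \<D>(3)[of "1 / real (Suc m)" "g + h"] by auto
    \<comment> \<open>Membership passes from \<open>E\<close> to the open set \<open>U\<close> at
      \<open>g + h\<close>, along the convergent sequence inside \<open>U\<close>, and back to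
      \<open>E\<close> at \<open>s n + h\<close>.\<close>
    have "g + h \<in> U (D, m)"
      using U(2)[of "(D, m)" g] D by (auto simp: E_def)
    moreover have "(\<lambda>n. s n + h) \<longlonglongrightarrow> g + h" by (intro tendsto_intros lim)
    ultimately have "\<forall>\<^sub>F n in sequentially. s n + h \<in> U (D, m)"
      using U(1)[of "(D, m)"] D(1) by (auto dest: topological_tendstoD)
    then show "\<forall>\<^sub>F n in sequentially. measure M (sym_diff (S (s n + h)) (S (g + h))) < r"
    proof eventually_elim
      case (elim n)
      then have "measure M (sym_diff (S (s n + h)) D) < 1 / real (Suc m)"
        using U(2)[of "(D, m)" "s n"] D(1) by (auto simp: E_def)
      moreover have "D \<in> sets M" using D(1) \<D>(2) by blast
      ultimately show ?case
        using D(2) m measure_sym_diff_triangle[OF S _ S, of D "s n + h" "g + h"] by linarith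
    qed
  qed (auto intro!: always_eventually order_less_le_trans[OF _ measure_nonneg])
  \<comment> \<open>The preimage of \<open>S (k + h)\<close> under \<open>act (- h)\<close> is
    \<open>S k\<close>, so \<open>?N\<close> measures the symmetric differences with
    \<open>h\<close> removed. Nonsingularity carries the limit from \<open>M\<close> to
    \<open>?N\<close>.\<close>
  let ?N = "distr M M (act (- h))"
  have "(\<lambda>n. measure ?N (sym_diff (S (s n + h)) (S (g + h)))) \<longlonglongrightarrow> 0"
  proof (rule tendsto_measure_absolutely_continuous[OF _ _ _ _ _ lim_h])
    show "finite_measure ?N" by (intro finite_measure_distr act_measurable[OF act])
    show "absolutely_continuous M ?N" using act by (auto simp: nonsingular_action_def)
  qed (use S assms(2) in auto)
  moreover have "measure ?N (sym_diff (S (k + h)) (S (l + h))) = measure M (sym_diff (S k) (S l))" for k l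
  proof -
    have "act (- h) x \<in> S (k + h) \<longleftrightarrow> x \<in> S k" if "x \<in> space M" for x k
    proof -
      have "act (k + h) (act (- h) x) = act (k + h + - h) x"
        using act that unfolding nonsingular_action_def by metis
      then show ?thesis
        using that measurable_space[OF act_measurable[OF act] that]
        by (simp add: S_def add.assoc)
    qed
    then have "act (- h) -` sym_diff (S (k + h)) (S (l + h)) \<inter> space M = sym_diff (S k) (S l)"
      by (auto simp: S_def)
    then show ?thesis
      using S act_measurable[OF act] by (subst measure_distr) auto
  qed
  ultimately show ?thesis by (simp add: S_def)
qed

section \<open>From sets to bounded functions\<close>

lemma tendsto_L1_translated_function:
  fixes act :: "'g::{topological_group_add, t2_space} \<Rightarrow> 'a \<Rightarrow> 'a"
  assumes "locally_compact_space (euclidean :: 'g topology)" "prob_space M"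
    and act: "nonsingular_action M act" and f: "f \<in> Linf_fun M" and lim: "s \<longlonglongrightarrow> g"
  shows "(\<lambda>n. LINT x|M. norm (f (act (s n) x) - f (act g x))) \<longlonglongrightarrow> 0"
proof (rule order_tendstoI)
  interpret prob_space M by fact
  fix r :: real assume "0 < r"
  \<comment> \<open>Two thirds of \<open>r\<close> bound the distance of two values in one ball of
    radius \<open>e\<close>, the last third the contribution of the exceptional sets.\<close>
  define e where "e = r / 3"
  have e: "0 < e" "r = 3 * e" using \<open>0 < r\<close> by (auto simp: e_def)
  have fM: "f \<in> borel_measurable M" using f by (simp add: Linf_fun_def)
  obtain C where C: "AE x in M. norm (f x) \<le> C"
    using f by (auto simp: Linf_fun_def)
  have "0 \<le> C"
  proof -
    have "AE x in M. 0 \<le> C"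
      using C by eventually_elim (meson norm_ge_zero order_trans)
    then show ?thesis by simp
  qed
  obtain Z :: "complex set" where Z: "finite Z" "cball 0 C \<subseteq> (\<Union>z\<in>Z. ball z e)"
    using seq_compact_imp_totally_bounded[OF compact_imp_seq_compact[OF compact_cball],
        rule_format, OF e(1), of "0::complex" C] by (elim exE conjE)
  \<comment> \<open>These are the points for which exactly one of \<open>act (s n)\<close> and
    \<open>act g\<close> leads to a value of \<open>f\<close> in \<open>ball z e\<close>.\<close>
  let ?\<Delta> = "\<lambda>z n. sym_diff (act (s n) -` (f -` ball z e \<inter> space M) \<inter> space M)
    (act g -` (f -` ball z e \<inter> space M) \<inter> space M)"
  have B: "f -` ball z e \<inter> space M \<in> sets M" for z
    using fM by measurable
  have \<Delta>: "?\<Delta> z n \<in> sets M" for z n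
    by (intro sets.Un sets.Diff measurable_sets[OF act_measurable[OF act] B])
  have "(\<lambda>n. 2 * C * (\<Sum>z\<in>Z. measure M (?\<Delta> z n))) \<longlonglongrightarrow> 2 * C * (\<Sum>z\<in>Z. 0)"
    by (intro tendsto_intros tendsto_measure_translated_sets assms B) unfold_locales
  then have "\<forall>\<^sub>F n in sequentially. 2 * C * (\<Sum>z\<in>Z. measure M (?\<Delta> z n)) < e"
    using e by (intro order_tendstoD(2)) auto
  then show "\<forall>\<^sub>F n in sequentially. (LINT x|M. norm (f (act (s n) x) - f (act g x))) < r"
  proof eventually_elim
    case (elim n)
    have "(LINT x|M. norm (f (act (s n) x) - f (act g x))) \<le>
        (LINT x|M. 2 * e + 2 * C * (\<Sum>z\<in>Z. indicator (?\<Delta> z n) x))"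
    proof (rule integral_mono_AE)
      show "integrable M (\<lambda>x. norm (f (act (s n) x) - f (act g x)))"
        by (intro integrable_norm Linf_fun_integrable[OF assms(2)] Linf_fun_diff
            Linf_fun_act[OF act] f)
      show "integrable M (\<lambda>x. 2 * e + 2 * C * (\<Sum>z\<in>Z. indicator (?\<Delta> z n) x))"
        using \<Delta> by (intro Bochner_Integration.integrable_add integrable_mult_right
            Bochner_Integration.integrable_sum) (auto intro!: integrable_real_indicator simp: less_top[symmetric])
      show "AE x in M. norm (f (act (s n) x) - f (act g x)) \<le>
          2 * e + 2 * C * (\<Sum>z\<in>Z. indicator (?\<Delta> z n) x)"
        using act_AE[OF act C, of g] act_AE[OF act C, of "s n"] AE_space
      proof eventually_elim
        case (elim x)
        \<comment> \<open>The centre \<open>z\<close> depends on \<open>x\<close>. Off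
          \<open>?\<Delta> z n\<close> both values lie in the same ball; on it the essential bound
          gives \<open>2 * C\<close>, and the sum over all of \<open>Z\<close> dominates the
          indicator of this \<open>z\<close>.\<close>
        then obtain z where z: "z \<in> Z" "f (act g x) \<in> ball z e"
          using Z(2) by (auto simp: subset_iff)
        show ?case
        proof (cases "x \<in> ?\<Delta> z n")
          case True
          then have "1 = indicat_real (?\<Delta> z n) x" by simp
          also have "\<dots> \<le> (\<Sum>z\<in>Z. indicat_real (?\<Delta> z n) x)"
            using Z(1) z(1) by (intro member_le_sum) auto
          finally have "2 * C * 1 \<le> 2 * C * (\<Sum>z\<in>Z. indicat_real (?\<Delta> z n) x)"
            using \<open>0 \<le> C\<close> by (intro mult_left_mono) auto
          moreover have "norm (f (act (s n) x) - f (act g x)) \<le> 2 * C"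
            using elim norm_triangle_ineq4[of "f (act (s n) x)" "f (act g x)"] by linarith
          ultimately show ?thesis using e(1) by linarith
        next
          case False
          then have "f (act (s n) x) \<in> ball z e"
            using z elim measurable_space[OF act_measurable[OF act]] by auto
          with z(2) have "dist (f (act (s n) x)) (f (act g x)) \<le> 2 * e"
            using dist_triangle3[of "f (act (s n) x)" "f (act g x)" z] by auto
          moreover have "0 \<le> 2 * C * (\<Sum>z\<in>Z. indicat_real (?\<Delta> z n) x)"
            using \<open>0 \<le> C\<close> by (intro mult_nonneg_nonneg sum_nonneg) auto
          ultimately show ?thesis by (simp add: dist_norm)
        qed
      qed
    qed
    also have "\<dots> = 2 * e + 2 * C * (\<Sum>z\<in>Z. measure M (?\<Delta> z n))"
      using \<Delta> by (subst Bochner_Integration.integral_add)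
        (auto intro!: integrable_mult_right Bochner_Integration.integrable_sum
          integrable_real_indicator simp: less_top[symmetric] prob_space)
    also have "\<dots> < r" using elim e by linarith
    finally show ?case .
  qed
qed (auto intro!: always_eventually order_less_le_trans[OF _ Bochner_Integration.integral_nonneg])

section \<open>Continuity of the orbit maps on classes\<close>

theorem theorem2p1:
  fixes M :: "'a measure"
    and act :: "'g::{topological_group_add, t2_space, second_countable_topology} \<Rightarrow> 'a \<Rightarrow> 'a"
  assumes "locally_compact_space (euclidean :: 'g topology)"
    and "standard_prob_space M"
    and "nonsingular_action M act"
  shows "\<forall>F\<in>Linf M.
    continuous_map euclidean (Linf_L1_topology M) (\<lambda>g. koopman M act (- g) F)"
proof
  fix F assume F: "F \<in> Linf M"
  have M: "prob_space M" using assms(2) by (simp add: standard_prob_space_def)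
  interpret Metric_space "Linf M" "L1_dist M" by (rule Metric_space_Linf_L1[OF M])
  obtain f where f: "f \<in> Linf_fun M" "F = ae_eq M `` {f}"
    using F by (rule Linf_cases)
  show "continuous_map euclidean (Linf_L1_topology M) (\<lambda>g. koopman M act (- g) F)"
    unfolding Linf_L1_topology_def continuous_map_to_metric
  proof (intro ballI allI impI)
    fix g :: 'g and e :: real assume "0 < e"
    \<comment> \<open>The filter is just \<open>nhds g\<close>, written in the shape of the
      sequential criterion. Sequences suffice since a second countable group is first
      countable.\<close>
    have "\<forall>\<^sub>F k in inf (nhds g) (principal UNIV).
        (LINT x|M. norm (f (act (- k) x) - f (act (- g) x))) < e"
    proof (intro sequentially_imp_eventually_nhds_within allI impI, elim conjE)
      fix s assume "s \<longlonglongrightarrow> g"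
      then have "(\<lambda>n. - s n) \<longlonglongrightarrow> - g" by (rule tendsto_minus)
      from order_tendstoD(2)[OF tendsto_L1_translated_function[OF assms(1) M assms(3) f(1) this] \<open>0 < e\<close>]
      show "\<forall>\<^sub>F n in sequentially. (LINT x|M. norm (f (act (- s n) x) - f (act (- g) x))) < e" .
    qed
    then obtain U where "open U" "g \<in> U"
      "\<And>k. k \<in> U \<Longrightarrow> (LINT x|M. norm (f (act (- k) x) - f (act (- g) x))) < e"
      by (auto simp: eventually_nhds)
    \<comment> \<open>On classes \<open>L1_dist\<close> is the integral for representatives. The
      centre of \<open>mball\<close> comes first, so the difference appears reversed.\<close>
    then show "\<exists>U. openin euclidean U \<and> g \<in> U \<and>
        (\<forall>k\<in>U. koopman M act (- k) F \<in> mball (koopman M act (- g) F) e)"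
      using koopman_in_Linf[OF assms(3) F]
      by (intro exI[of _ U]) (auto simp: f koopman_class[OF assms(3)] L1_dist_class
          Linf_fun_act[OF assms(3)] norm_minus_commute)
  qed
qed

end
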